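(* Let $n$ be a positive integer and let $k,l$ be relatively prime positive integers with $k\le n$ and $l\le n$. Then for all nonnegative integers $i,j$, $$m_n^{k,l}(i,j)=\frac{n!}{kl}.$$
   Context: $S_n$ is the symmetric group on $[n]=\{1,\dots,n\}$. For $\pi=a_1a_2\cdots a_n\in S_n$ (one-line notation), the major index is $\mathrm{maj}\,\pi=\sum_{a_i>a_{i+1}} i$. For positive integers $k,l$ and nonnegative integers $i,j$, define $m_n^{k,l}(i,j)=\#\{\pi\in S_n:\ \mathrm{maj}\,\pi\equiv i \pmod k \text{ and } \mathrm{maj}\,\pi^{-1}\equiv j\pmod l\}$. *)

theory Defs
  imports Complex_Main "HOL-Combinatorics.Permutations" "HOL-Number_Theory.Cong"
begin

(* The one-line notation of p is p 1, p 2, ..., p n. *)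
definition maj :: "nat \<Rightarrow> (nat \<Rightarrow> nat) \<Rightarrow> nat" where
  "maj n p = (\<Sum>i | i \<in> {1..<n} \<and> p i > p (i + 1). i)"

definition maj_count :: "nat \<Rightarrow> nat \<Rightarrow> nat \<Rightarrow> nat \<Rightarrow> nat \<Rightarrow> nat" where
  "maj_count n k l i j =
     card {p. p permutes {1..n} \<and> [maj n p = i] (mod k) \<and> [maj n (inv p) = j] (mod l)}"

end

theory Submission
  imports Defs
begin

text \<open>By Fourier inversion it suffices that
  \<open>A(x, y) = (\<Sum>p. x ^ maj p * y ^ maj (inv p))\<close> vanishes whenever \<open>x\<close> and \<open>y\<close> are roots of unity of
  different orders \<open>d, e \<le> n\<close>; by symmetry let \<open>e < d\<close>. Expand \<open>y ^ maj (inv p)\<close> as a combination,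
  over sets \<open>S\<close>, of the indicators that all descents of \<open>inv p\<close> lie in \<open>S\<close>. The coefficient of \<open>S\<close>
  contains the factors \<open>1 - y ^ i\<close> for \<open>i \<notin> S\<close>, so only those \<open>S\<close> matter which contain every
  multiple of \<open>e\<close>, and these cut \<open>{1..n}\<close> into intervals of length at most \<open>e\<close>. By MacMahon, the sum of
  \<open>x ^ maj p\<close> over the permutations selected by \<open>S\<close> is the \<open>x\<close>-multinomial coefficient of the interval
  lengths. As these are smaller than \<open>d \<le> n\<close>, its denominator is nonzero whereas its numerator
  contains \<open>1 - x ^ d = 0\<close>.\<close>

section \<open>Major index of block shuffles\<close>

text \<open>List positions start at 0, so \<open>i\<close> compares the \<open>i\<close>-th letter
  with its successor in the usual numbering from 1.\<close>

definition list_maj :: "'a::linorder list \<Rightarrow> nat" where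
  "list_maj xs = (\<Sum>i | i \<in> {1..<length xs} \<and> xs ! (i - 1) > xs ! i. i)"

lemma list_maj_singleton [simp]: "list_maj [x] = 0"
  by (simp add: list_maj_def)

lemma list_maj_snoc:
  "list_maj (ys @ [x]) = list_maj ys + (if ys \<noteq> [] \<and> x < last ys then length ys else 0)"
proof (cases "ys = []")
  case True
  then show ?thesis by (simp add: list_maj_def)
next
  case False
  let ?D = "{i. i \<in> {1..<length ys} \<and> ys ! (i - 1) > ys ! i}"
  have eq: "{i. i \<in> {1..<length (ys @ [x])} \<and> (ys @ [x]) ! (i - 1) > (ys @ [x]) ! i}
     = ?D \<union> (if x < last ys then {length ys} else {})" (is "?L = ?R")
  proof (rule set_eqI)
    fix i
    show "i \<in> ?L \<longleftrightarrow> i \<in> ?R"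
      using False by (cases "i = length ys") (auto simp: nth_append last_conv_nth Suc_le_eq)
  qed
  show ?thesis
    unfolding list_maj_def eq using False by (simp add: sum.union_disjoint)
qed

text \<open>If \<open>b\<close> is monotone, its fibres are consecutive blocks of \<open>A\<close>,
  and these words are the shuffles of the increasing words on the blocks. The strict
  \<open><\<close> also rules out repeated letters.\<close>

definition block_shuffles :: "('a::linorder \<Rightarrow> nat) \<Rightarrow> 'a set \<Rightarrow> 'a list set" where
  "block_shuffles b A = {xs. set xs = A \<and> sorted_wrt (\<lambda>x y. b x = b y \<longrightarrow> x < y) xs}"

lemma block_shuffles_distinct: "xs \<in> block_shuffles b A \<Longrightarrow> distinct xs"
proof -
  have "sorted_wrt (\<lambda>x y. b x = b y \<longrightarrow> x < y) xs \<Longrightarrow> distinct xs"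
    by (induction xs) auto
  then show "xs \<in> block_shuffles b A \<Longrightarrow> distinct xs"
    by (simp add: block_shuffles_def)
qed

lemma block_shuffles_length: "xs \<in> block_shuffles b A \<Longrightarrow> length xs = card A"
  using block_shuffles_distinct[of xs b A] distinct_card[of xs]
  by (auto simp: block_shuffles_def)

lemma finite_block_shuffles:
  assumes "finite A" shows "finite (block_shuffles b A)"
proof (rule finite_subset)
  show "block_shuffles b A \<subseteq> {xs. set xs \<subseteq> A \<and> length xs = card A}"
    using block_shuffles_length by (auto simp: block_shuffles_def)
  show "finite {xs. set xs \<subseteq> A \<and> length xs = card A}"
    using assms by (rule finite_lists_length_eq)
qed

text \<open>All other letters of its block precede the last letter, which is therefore the maximum
  \<open>x\<close> of that block. Deleting or appending this \<open>x\<close> keeps the order within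
  every block, which gives a recursion on words.\<close>

lemma block_shuffles_last:
  assumes "finite A" "{a \<in> A. b a = c} \<noteq> {}"
  defines "x \<equiv> Max {a \<in> A. b a = c}"
  shows "{xs \<in> block_shuffles b A. xs \<noteq> [] \<and> b (last xs) = c}
     = (\<lambda>ys. ys @ [x]) ` block_shuffles b (A - {x})" (is "?L = ?R")
proof -
  have fin: "finite {a \<in> A. b a = c}" using assms by auto
  have x: "x \<in> A" "b x = c" using Max_in[OF fin assms(2)] by (auto simp: x_def)
  have mx: "a \<le> x" if "a \<in> A" "b a = c" for a
    unfolding x_def using fin that by (intro Max_ge) auto
  show ?thesis
  proof (intro equalityI subsetI)
    fix xs assume "xs \<in> ?L"
    then have xs: "set xs = A" "sorted_wrt (\<lambda>x y. b x = b y \<longrightarrow> x < y) xs"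
      "xs \<noteq> []" "b (last xs) = c" "xs \<in> block_shuffles b A"
      by (auto simp: block_shuffles_def)
    obtain ys y where ys: "xs = ys @ [y]" using xs(3) by (metis rev_exhaust)
    have "y = x"
    proof (rule ccontr)
      assume "y \<noteq> x"
      then have "x \<in> set ys" using x xs(1) ys by auto
      then have "x < y" using xs(2,4) x ys by (auto simp: sorted_wrt_append)
      moreover have "y \<le> x" using mx[of y] xs ys by auto
      ultimately show False by simp
    qed
    moreover have "ys \<in> block_shuffles b (A - {x})"
      using xs(1,2) ys block_shuffles_distinct[OF xs(5)] \<open>y = x\<close>
      by (auto simp: block_shuffles_def sorted_wrt_append)
    ultimately show "xs \<in> ?R" using ys by auto
  next
    fix xs assume "xs \<in> ?R"
    then obtain ys where ys: "xs = ys @ [x]" "ys \<in> block_shuffles b (A - {x})" by auto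
    have "a < x" if "a \<in> set ys" "b a = c" for a
    proof -
      have "a \<in> A" "a \<noteq> x" using that ys by (auto simp: block_shuffles_def)
      then show ?thesis using mx[of a] that by auto
    qed
    then show "xs \<in> ?L"
      using ys x by (auto simp: block_shuffles_def sorted_wrt_append)
  qed
qed

text \<open>The q-Pochhammer symbol (q;q)_m, which up to a power of 1 - q is the q-analogue of
  m!.\<close>

definition q_poch :: "'b::comm_ring_1 \<Rightarrow> nat \<Rightarrow> 'b" where
  "q_poch q m = (\<Prod>i=1..m. 1 - q ^ i)"

lemma q_poch_0 [simp]: "q_poch q 0 = 1"
  by (simp add: q_poch_def)

lemma q_poch_Suc: "q_poch q (Suc m) = q_poch q m * (1 - q ^ Suc m)"
  by (simp add: q_poch_def)

section \<open>Telescoping sums over block sizes\<close>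

abbreviation block :: "('a \<Rightarrow> nat) \<Rightarrow> 'a set \<Rightarrow> nat \<Rightarrow> 'a set" where
  "block b A c \<equiv> {a \<in> A. b a = c}"

abbreviation higher :: "('a \<Rightarrow> nat) \<Rightarrow> 'a set \<Rightarrow> nat \<Rightarrow> 'a set" where
  "higher b A c \<equiv> {a \<in> A. b a > c}"

text \<open>The elements above \<open>c - 1\<close> are those above \<open>c\<close> together with
  block \<open>c\<close>, so each summand is a difference of consecutive powers, starting from
  \<open>q ^ card A\<close> at \<open>c = 0\<close>.\<close>

lemma telescope_blocks_le:
  fixes q :: "'b::comm_ring_1"
  assumes "finite A"
  shows "(\<Sum>c\<le>m. q ^ card (higher b A c) * (1 - q ^ card (block b A c)))
    = q ^ card (higher b A m) - q ^ card A"
proof (induction m)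
  case 0
  have "A = higher b A 0 \<union> block b A 0" by auto
  then have "card A = card (higher b A 0) + card (block b A 0)"
    using assms by (subst card_Un_disjoint[symmetric]) auto
  then show ?case by (simp add: algebra_simps power_add)
next
  case (Suc m)
  have "higher b A m = higher b A (Suc m) \<union> block b A (Suc m)" by auto
  then have "card (higher b A m) = card (higher b A (Suc m)) + card (block b A (Suc m))"
    using assms by (subst card_Un_disjoint[symmetric]) auto
  then show ?case using Suc by (simp add: algebra_simps power_add)
qed

lemma telescope_blocks_gt:
  fixes q :: "'b::comm_ring_1"
  assumes "finite A" "\<forall>a\<in>A. b a \<le> N" "m \<le> N"
  shows "(\<Sum>c\<in>{m<..N}. q ^ card (higher b A c) * (1 - q ^ card (block b A c)))
    = 1 - q ^ card (higher b A m)"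
proof -
  let ?f = "\<lambda>c. q ^ card (higher b A c) * (1 - q ^ card (block b A c))"
  have "{..N} = {..m} \<union> {m<..N}" using assms by auto
  then have "sum ?f {..N} = sum ?f {..m} + sum ?f {m<..N}"
    by (simp add: sum.union_disjoint ivl_disj_int)
  moreover have "higher b A N = {}" using assms by fastforce
  then have "card (higher b A N) = 0" by (metis card.empty)
  ultimately have "1 - q ^ card A = (q ^ card (higher b A m) - q ^ card A) + sum ?f {m<..N}"
    using telescope_blocks_le[OF assms(1), of q b N] telescope_blocks_le[OF assms(1), of q b m]
    by (simp only: power_0)
  then show ?thesis by (simp add: algebra_simps)
qed

section \<open>MacMahon's product formula by recursion on the last letter\<close>

definition last_in_block where
  "last_in_block b A c = {xs \<in> block_shuffles b A. xs \<noteq> [] \<and> b (last xs) = c}"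

lemma sum_block_shuffles_by_last:
  fixes f :: "'a::linorder list \<Rightarrow> 'b::comm_ring_1"
  assumes "finite A" "A \<noteq> {}" "\<forall>a\<in>A. b a \<le> N"
  shows "sum f (block_shuffles b A) = (\<Sum>c\<le>N. sum f (last_in_block b A c))"
proof -
  have "block_shuffles b A = (\<Union>c\<le>N. last_in_block b A c)"
  proof -
    have "xs \<noteq> [] \<and> b (last xs) \<le> N" if "xs \<in> block_shuffles b A" for xs
    proof -
      have "set xs = A" using that by (simp add: block_shuffles_def)
      then show ?thesis using assms(2,3) last_in_set[of xs] by auto
    qed
    then show ?thesis by (auto simp: last_in_block_def)
  qed
  then have "sum f (block_shuffles b A) = sum f (\<Union>c\<le>N. last_in_block b A c)" by (rule arg_cong)
  also have "\<dots> = (\<Sum>c\<le>N. sum f (last_in_block b A c))"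
    by (rule sum.UNION_disjoint)
      (auto simp: last_in_block_def finite_block_shuffles[OF assms(1)])
  finally show ?thesis .
qed

text \<open>MacMahon's \<open>q\<close>-multinomial theorem, refined by the block of the last letter. Denominators
  are cleared so that \<open>q\<close> may later be a root of unity.\<close>

lemma maj_last_in_block:
  fixes q :: "'b::comm_ring_1" and b :: "'a::linorder \<Rightarrow> nat"
  assumes "mono b" "finite A" "\<forall>a\<in>A. b a \<le> N" "A \<noteq> {}" "c \<le> N"
  shows "(\<Sum>xs\<in>last_in_block b A c. q ^ list_maj xs) * (\<Prod>c\<le>N. q_poch q (card (block b A c)))
     = q ^ card (higher b A c) * (1 - q ^ card (block b A c)) * q_poch q (card A - 1)"
  using assms
\<comment> \<open>Delete the last letter \<open>x\<close>. The remaining word may end in any block,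
  so \<open>c\<close> has to vary along with \<open>A\<close>.\<close>
proof (induction "card A" arbitrary: A c rule: less_induct)
  case less
  show ?case
  proof (cases "block b A c = {}")
    case True
    then have "last_in_block b A c = {}"
      by (force simp: last_in_block_def block_shuffles_def)
    moreover have "card (block b A c) = 0" using True by (metis card.empty)
    ultimately show ?thesis by simp
  next
    case False
    define x where "x = Max (block b A c)"
    define B where "B = A - {x}"
    have finc: "finite (block b A c)" using less.prems by auto
    have x: "x \<in> A" "b x = c" using Max_in[OF finc False] by (auto simp: x_def)
    have mx: "a \<le> x" if "a \<in> A" "b a = c" for a
      unfolding x_def using finc that by (intro Max_ge) auto
    have finB: "finite B" using less.prems by (simp add: B_def)
    have cA: "card A = Suc (card B)"
      using card_Suc_Diff1[OF less.prems(2) x(1)] by (simp add: B_def)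
    have "block b B c = block b A c - {x}" by (auto simp: B_def)
    then have cblock: "card (block b A c) = Suc (card (block b B c))"
      using card_Suc_Diff1[OF finc, of x] x by simp
    have other: "block b A c' = block b B c'" if "c' \<noteq> c" for c'
      using x that by (auto simp: B_def)
    have highB: "higher b B c = higher b A c" using x by (auto simp: B_def)
    \<comment> \<open>Deleting \<open>x\<close> shrinks only block \<open>c\<close>, so exactly one
      factor of the denominator \<open>?T\<close> loses its top term.\<close>
    let ?T = "\<lambda>A. \<Prod>c\<le>N. q_poch q (card (block b A c))"
    have "?T A = q_poch q (card (block b A c)) * (\<Prod>c\<in>{..N}-{c}. q_poch q (card (block b A c)))"
      using less.prems by (subst prod.remove[of _ c]) auto
    also have "(\<Prod>c\<in>{..N}-{c}. q_poch q (card (block b A c)))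
        = (\<Prod>c\<in>{..N}-{c}. q_poch q (card (block b B c)))"
      by (rule prod.cong) (auto simp: other)
    also have "q_poch q (card (block b A c)) * \<dots> = (1 - q ^ card (block b A c)) * ?T B"
      using less.prems by (subst prod.remove[of "{..N}" c]) (auto simp: cblock q_poch_Suc)
    finally have T: "?T A = (1 - q ^ card (block b A c)) * ?T B" .
    have L: "last_in_block b A c = (\<lambda>ys. ys @ [x]) ` block_shuffles b B"
      unfolding last_in_block_def B_def x_def
      by (rule block_shuffles_last) (use less.prems False in auto)
    have S: "(\<Sum>xs\<in>last_in_block b A c. q ^ list_maj xs)
        = (\<Sum>ys\<in>block_shuffles b B. q ^ list_maj (ys @ [x]))"
      unfolding L by (subst sum.reindex) (auto simp: inj_on_def)
    show ?thesis
    proof (cases "B = {}")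
      case True
      then have "block_shuffles b B = {[]}" by (auto simp: block_shuffles_def)
      moreover have "card (higher b A c) = 0" unfolding highB[symmetric] True by simp
      ultimately show ?thesis
        using True cA cblock
        by (simp add: S T)
    next
      case Bne: False
      have bB: "\<forall>a\<in>B. b a \<le> N" using less.prems by (auto simp: B_def)
      let ?g = "\<lambda>c'. q ^ card (higher b B c') * (1 - q ^ card (block b B c'))"
      let ?W = "\<lambda>c'. \<Sum>ys\<in>last_in_block b B c'. q ^ list_maj ys"
      let ?V = "\<lambda>c'. \<Sum>ys\<in>last_in_block b B c'. q ^ list_maj (ys @ [x])"
      have IH: "?W c' * ?T B = ?g c' * q_poch q (card B - 1)" if "c' \<le> N" for c'
        using less.hyps[of B c'] that cA less.prems(1) finB bB Bne by simp
      \<comment> \<open>Appending \<open>x\<close> creates a descent exactly if the previous letter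
        lies in a higher block: across blocks this is monotonicity of \<open>b\<close>, and within
        block \<open>c\<close> the letter \<open>x\<close> is maximal.\<close>
      have last: "x < last ys \<longleftrightarrow> c < c'" "ys \<noteq> []" "length ys = card B"
        if "ys \<in> last_in_block b B c'" for ys c'
      proof -
        have ys: "ys \<in> block_shuffles b B" "ys \<noteq> []" "b (last ys) = c'"
          using that by (auto simp: last_in_block_def)
        then have "last ys \<in> B" using last_in_set[of ys] by (auto simp: block_shuffles_def)
        then have "last ys \<in> A" "last ys \<noteq> x" by (auto simp: B_def)
        then show "x < last ys \<longleftrightarrow> c < c'"
          using mx[of "last ys"] ys x monoD[OF less.prems(1), of x "last ys"]
            monoD[OF less.prems(1), of "last ys" x]
          by (cases "x < last ys") (auto simp: not_less order.order_iff_strict)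
        show "ys \<noteq> []" "length ys = card B"
          using ys block_shuffles_length by auto
      qed
      have V: "?V c' = ?W c' * (if c < c' then q ^ card B else 1)" for c'
        by (auto simp: sum_distrib_right list_maj_snoc last power_add intro!: sum.cong)
      have VT: "?V c' * ?T B = ?g c' * (if c < c' then q ^ card B else 1) * q_poch q (card B - 1)"
        if "c' \<le> N" for c'
      proof -
        have "?V c' * ?T B = ?W c' * ?T B * (if c < c' then q ^ card B else 1)"
          unfolding V by (simp only: mult_ac)
        then show ?thesis unfolding IH[OF that] by (simp only: mult_ac)
      qed
      have "(\<Sum>xs\<in>last_in_block b A c. q ^ list_maj xs) * ?T B = (\<Sum>c'\<le>N. ?V c' * ?T B)"
        unfolding S using sum_block_shuffles_by_last[OF finB Bne bB]
        by (simp add: sum_distrib_right)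
      also have "\<dots> = (\<Sum>c'\<le>N. ?g c' * (if c < c' then q ^ card B else 1)) * q_poch q (card B - 1)"
        by (subst sum_distrib_right[of _ "{..N}"], rule sum.cong) (simp_all only: VT atMost_iff)
      also have "(\<Sum>c'\<le>N. ?g c' * (if c < c' then q ^ card B else 1))
          = (\<Sum>c'\<le>c. ?g c') + (\<Sum>c'\<in>{c<..N}. ?g c') * q ^ card B"
      proof -
        have "{..N} = {..c} \<union> {c<..N}" using less.prems by auto
        then have "(\<Sum>c'\<le>N. ?g c' * (if c < c' then q ^ card B else 1))
          = (\<Sum>c'\<le>c. ?g c' * (if c < c' then q ^ card B else 1))
          + (\<Sum>c'\<in>{c<..N}. ?g c' * (if c < c' then q ^ card B else 1))"
          by (simp add: sum.union_disjoint ivl_disj_int)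
        also have "\<dots> = (\<Sum>c'\<le>c. ?g c') + (\<Sum>c'\<in>{c<..N}. ?g c' * q ^ card B)"
          by (intro arg_cong2[of _ _ _ _ "(+)"] sum.cong) auto
        finally show ?thesis by (simp add: sum_distrib_right)
      qed
      \<comment> \<open>With \<open>h = card (higher b A c)\<close>, the two ranges telescope to
        \<open>q ^ h - q ^ card B\<close> and \<open>(1 - q ^ h) * q ^ card B\<close>.\<close>
      also have "\<dots> = q ^ card (higher b A c) * (1 - q ^ card B)"
        unfolding telescope_blocks_le[OF finB] telescope_blocks_gt[OF finB bB less.prems(5)] highB
        by (simp add: algebra_simps)
      also have "\<dots> * q_poch q (card B - 1) = q ^ card (higher b A c) * q_poch q (card B)"
      proof -
        obtain m where "card B = Suc m" using Bne finB by (metis card_0_eq not0_implies_Suc)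
        then show ?thesis by (simp add: q_poch_Suc mult_ac)
      qed
      finally have main: "(\<Sum>xs\<in>last_in_block b A c. q ^ list_maj xs) * ?T B
          = q ^ card (higher b A c) * q_poch q (card B)" .
      have "(\<Sum>xs\<in>last_in_block b A c. q ^ list_maj xs) * ?T A
         = (\<Sum>xs\<in>last_in_block b A c. q ^ list_maj xs) * ?T B * (1 - q ^ card (block b A c))"
        unfolding T by (simp only: mult_ac)
      then show ?thesis unfolding main using cA by (simp add: mult_ac)
    qed
  qed
qed

text \<open>Summing the refined formula over the last block telescopes to
  \<open>1 - q ^ card A\<close>, since nothing lies above block \<open>N\<close>. This factor
  completes the numerator.\<close>

lemma maj_block_shuffles:
  fixes q :: "'b::comm_ring_1" and b :: "'a::linorder \<Rightarrow> nat"
  assumes "mono b" "finite A" "\<forall>a\<in>A. b a \<le> N" "A \<noteq> {}"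
  shows "(\<Sum>xs\<in>block_shuffles b A. q ^ list_maj xs) * (\<Prod>c\<le>N. q_poch q (card (block b A c)))
     = q_poch q (card A)"
proof -
  have "(\<Sum>xs\<in>block_shuffles b A. q ^ list_maj xs) * (\<Prod>c\<le>N. q_poch q (card (block b A c)))
     = (\<Sum>c\<le>N. q ^ card (higher b A c) * (1 - q ^ card (block b A c))) * q_poch q (card A - 1)"
    unfolding sum_block_shuffles_by_last[OF assms(2,4,3)] sum_distrib_right
    by (rule sum.cong) (use maj_last_in_block[OF assms] in \<open>auto simp: sum_distrib_right\<close>)
  also have "higher b A N = {}" using assms by fastforce
  then have "card (higher b A N) = 0" by (metis card.empty)
  then have "(\<Sum>c\<le>N. q ^ card (higher b A c) * (1 - q ^ card (block b A c))) = 1 - q ^ card A"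
    using telescope_blocks_le[OF assms(2), of q b N] by simp
  also have "(1 - q ^ card A) * q_poch q (card A - 1) = q_poch q (card A)"
  proof -
    obtain m where "card A = Suc m" using assms by (metis card_0_eq not0_implies_Suc)
    then show ?thesis by (simp add: q_poch_Suc mult_ac)
  qed
  finally show ?thesis .
qed

text \<open>As \<open>q\<close> is a primitive \<open>d\<close>-th root of unity,
  \<open>q_poch q m\<close> is nonzero for \<open>m < d\<close> and zero from \<open>d\<close> on.
  The denominator can thus be cancelled in the integral domain, while the numerator
  vanishes.\<close>

lemma maj_block_shuffles_root_of_unity:
  fixes q :: "'b::idom" and b :: "'a::linorder \<Rightarrow> nat"
  assumes "mono b" "finite A" "\<And>c. card (block b A c) < d" "d \<le> card A" "0 < d"
    and q: "\<And>m. q ^ m = 1 \<longleftrightarrow> d dvd m"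
  shows "(\<Sum>xs\<in>block_shuffles b A. q ^ list_maj xs) = 0"
proof -
  have ne: "A \<noteq> {}" using assms by auto
  define N where "N = Max (b ` A)"
  have N: "\<forall>a\<in>A. b a \<le> N" using assms by (auto simp: N_def)
  have "q_poch q m \<noteq> 0" if "m < d" for m
    using that q by (auto simp: q_poch_def dest: dvd_imp_le)
  then have "(\<Prod>c\<le>N. q_poch q (card (block b A c))) \<noteq> 0"
    using assms(3) by simp
  moreover have "q_poch q (card A) = 0"
    using assms(4,5) q[of d] by (auto simp: q_poch_def intro!: bexI[of _ d])
  ultimately show ?thesis
    using maj_block_shuffles[OF assms(1,2) N ne, of q] by simp
qed

section \<open>Permutations with prescribed inverse descents\<close>

definition descents :: "nat \<Rightarrow> (nat \<Rightarrow> nat) \<Rightarrow> nat set" where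
  "descents n p = {i \<in> {1..<n}. p i > p (i + 1)}"

lemma list_maj_one_line: "list_maj (map p [1..<Suc n]) = maj n p"
  unfolding list_maj_def maj_def
  by (rule sum.cong) (auto simp del: upt_Suc)

text \<open>This counting function serves as the block index: it rises by one just after each
  element of \<open>S\<close>, so its level sets are the intervals between the cuts.\<close>

lemma mono_card_below:
  fixes S :: "nat set"
  assumes "finite S"
  shows "mono (\<lambda>i. card {s \<in> S. s < i})"
  by (rule monoI, rule card_mono) (use assms in auto)

lemma card_below_Suc_eq:
  fixes i :: nat
  assumes "i \<notin> S"
  shows "card {s \<in> S. s < Suc i} = card {s \<in> S. s < i}"
proof -
  have "{s \<in> S. s < Suc i} = {s \<in> S. s < i}" using assms by (auto simp: less_Suc_eq)
  then show ?thesis by simp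
qed

lemma card_below_eq_imp_notin:
  fixes i j s :: nat
  assumes "finite S" "card {s \<in> S. s < i} = card {s \<in> S. s < j}" "i \<le> s" "s < j"
  shows "s \<notin> S"
proof
  assume "s \<in> S"
  have "{s \<in> S. s < i} \<subset> {s \<in> S. s < j}"
  proof (rule psubsetI)
    show "{s \<in> S. s < i} \<subseteq> {s \<in> S. s < j}" using assms(3,4) by auto
    have "s \<in> {s \<in> S. s < j}" "s \<notin> {s \<in> S. s < i}" using \<open>s \<in> S\<close> assms(3,4) by auto
    then show "{s \<in> S. s < i} \<noteq> {s \<in> S. s < j}" by blast
  qed
  then have "card {s \<in> S. s < i} < card {s \<in> S. s < j}"
    using assms(1) by (intro psubset_card_mono) auto
  then show False using assms(2) by simp
qed

text \<open>\<open>inv p\<close> gives the positions of the letters, so it has no descent at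
  \<open>i\<close> exactly if \<open>i\<close> stands before \<open>i + 1\<close> in the word of
  \<open>p\<close>. Allowing descents only at the cuts in \<open>S\<close> thus means that each
  block appears in increasing order.\<close>

lemma bij_betw_inverse_descents_block_shuffles:
  assumes S: "S \<subseteq> {1..<n}"
  shows "bij_betw (\<lambda>p. map p [1..<Suc n]) {p. p permutes {1..n} \<and> descents n (inv p) \<subseteq> S}
    (block_shuffles (\<lambda>i. card {s \<in> S. s < i}) {1..n})"
    (is "bij_betw ?h ?P ?B")
proof -
  let ?b = "\<lambda>i. card {s \<in> S. s < i}"
  have finS: "finite S" using S finite_subset by blast
  have inj: "inj_on ?h ?P"
  proof (rule inj_onI)
    fix p r assume p: "p \<in> ?P" and r: "r \<in> ?P" and eq: "?h p = ?h r"
    show "p = r"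
    proof
      fix i
      show "p i = r i"
      proof (cases "i \<in> {1..n}")
        case True
        then show ?thesis using eq by (auto simp: map_eq_conv simp del: upt_Suc)
      next
        case False
        then show ?thesis using p r permutes_not_in[of p "{1..n}" i] permutes_not_in[of r "{1..n}" i]
          by simp
      qed
    qed
  qed
  have sub: "?h p \<in> ?B" if "p \<in> ?P" for p
  proof -
    have p: "p permutes {1..n}" and D: "descents n (inv p) \<subseteq> S" using that by auto
    have ip: "inv p permutes {1..n}" using p by (rule permutes_inv)
    have step: "inv p i < inv p (Suc i)" if "i \<in> {1..<n}" "i \<notin> S" for i
    proof -
      have "\<not> inv p i > inv p (Suc i)" using D that by (auto simp: descents_def)
      moreover have "inv p i \<noteq> inv p (Suc i)"
        using permutes_inj[OF ip] by (simp add: inj_eq)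
      ultimately show ?thesis by simp
    qed
    \<comment> \<open>Climbing from \<open>i\<close> to \<open>j\<close> by unit steps never crosses
      a cut, since the monotone block index agrees at both ends.\<close>
    have incr: "inv p i < inv p j" if "i < j" "1 \<le> i" "j \<le> n" "?b i = ?b j" for i j
      using that
    proof (induction rule: less_Suc_induct)
      case (1 i)
      then show ?case using card_below_eq_imp_notin[OF finS, of i "Suc i" i] by (intro step) auto
    next
      case (2 i j k)
      have "?b i \<le> ?b j" "?b j \<le> ?b k"
        using 2 monoD[OF mono_card_below[OF finS]] by (meson less_imp_le)+
      then have "?b i = ?b j" "?b j = ?b k" using 2 by auto
      then show ?case using 2 by (meson less_trans less_imp_le order_trans)
    qed
    have "p u < p v" if "1 \<le> u" "u < v" "v \<le> n" "?b (p u) = ?b (p v)" for u v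
    proof (rule ccontr)
      assume "\<not> p u < p v"
      moreover have "p u \<noteq> p v" using permutes_inj[OF p] that(2) by (simp add: inj_eq)
      ultimately have "p v < p u" by simp
      moreover have "p u \<in> {1..n}" "p v \<in> {1..n}"
        using that permutes_in_image[OF p] by auto
      ultimately have "inv p (p v) < inv p (p u)"
        using incr[of "p v" "p u"] that by auto
      then show False using that permutes_inverses[OF p] by simp
    qed
    then have "sorted_wrt (\<lambda>x y. ?b x = ?b y \<longrightarrow> x < y) (?h p)"
      by (auto simp: sorted_wrt_iff_nth_less simp del: upt_Suc)
    moreover have "set (?h p) = {1..n}"
      using permutes_image[OF p] by (auto simp: atLeastLessThanSuc_atLeastAtMost simp del: upt_Suc)
    ultimately show ?thesis by (simp add: block_shuffles_def del: upt_Suc)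
  qed
  have sur: "xs \<in> ?h ` ?P" if xs: "xs \<in> ?B" for xs
  proof -
    have set: "set xs = {1..n}" and sorted: "sorted_wrt (\<lambda>x y. ?b x = ?b y \<longrightarrow> x < y) xs"
      using xs by (auto simp: block_shuffles_def)
    have len: "length xs = n" using block_shuffles_length[OF xs] by simp
    have dist: "distinct xs" using block_shuffles_distinct[OF xs] .
    \<comment> \<open>The word lists \<open>p 1\<close> at index 0. Outside \<open>{1..n}\<close> a
      permutation has to be the identity.\<close>
    define p where "p i = (if i \<in> {1..n} then xs ! (i - 1) else i)" for i
    have h: "?h p = xs"
      by (rule nth_equalityI) (auto simp: len p_def simp del: upt_Suc)
    have "inj_on p {1..n}"
    proof (rule inj_onI)
      fix i j assume "i \<in> {1..n}" "j \<in> {1..n}" "p i = p j"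
      then have "i - 1 = j - 1"
        using dist len by (auto simp: p_def nth_eq_iff_index_eq)
      then show "i = j" using \<open>i \<in> {1..n}\<close> \<open>j \<in> {1..n}\<close> by auto
    qed
    moreover have "p ` {1..n} = {1..n}"
    proof -
      have "set (?h p) = p ` {1..n}"
        by (simp add: atLeastLessThanSuc_atLeastAtMost del: upt_Suc)
      then show ?thesis by (simp only: h set)
    qed
    ultimately have p: "p permutes {1..n}"
      by (intro bij_imp_permutes) (auto simp: bij_betw_def p_def)
    have ip: "inv p permutes {1..n}" using p by (rule permutes_inv)
    \<comment> \<open>Otherwise \<open>i\<close> and \<open>Suc i\<close> would share a block
      although \<open>Suc i\<close> stands first in \<open>xs\<close>.\<close>
    have "i \<in> S" if "i \<in> descents n (inv p)" for i
    proof (rule ccontr)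
      assume "i \<notin> S"
      have i: "i \<in> {1..<n}" "inv p (Suc i) < inv p i" using that by (auto simp: descents_def)
      let ?u = "inv p (Suc i)" and ?v = "inv p i"
      have uv: "?u \<in> {1..n}" "?v \<in> {1..n}" 
        using i permutes_in_image[OF ip, of "Suc i"] permutes_in_image[OF ip, of i] by simp_all
      have pp: "p ?u = Suc i" "p ?v = i" using permutes_inverses[OF p] by auto
      have x: "xs ! (?u - 1) = Suc i" "xs ! (?v - 1) = i" using pp uv by (auto simp: p_def)
      have "?u - 1 < ?v - 1" "?v - 1 < length xs" using i uv len by auto
      then have "?b (Suc i) = ?b i \<longrightarrow> Suc i < i"
        using sorted_wrt_nth_less[OF sorted, of "?u - 1" "?v - 1"] by (simp only: x True_implies_equals)
      then have "Suc i < i" using card_below_Suc_eq[OF \<open>i \<notin> S\<close>] by (rule mp)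
      then show False by simp
    qed
    then have "p \<in> ?P" using p by auto
    with h[symmetric] show ?thesis by (rule image_eqI)
  qed
  show ?thesis unfolding bij_betw_def using inj sub sur by blast
qed

text \<open>Among \<open>e\<close> consecutive positions below \<open>n\<close> one is a multiple of
  \<open>e\<close>, hence a cut. So blocks have at most \<open>e < d\<close> elements and the
  vanishing of block shuffle sums applies.\<close>

lemma maj_inverse_descents_root_of_unity:
  fixes q :: "'b::idom"
  assumes S: "S \<subseteq> {1..<n}" and mult: "\<And>s. s \<in> {1..<n} \<Longrightarrow> e dvd s \<Longrightarrow> s \<in> S"
    and "0 < e" "e < d" "d \<le> n" and q: "\<And>m. q ^ m = 1 \<longleftrightarrow> d dvd m"
  shows "(\<Sum>p | p permutes {1..n} \<and> descents n (inv p) \<subseteq> S. q ^ maj n p) = 0"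
proof -
  let ?b = "\<lambda>i. card {s \<in> S. s < i}"
  have finS: "finite S" using S finite_subset by blast
  have "card (block ?b {1..n} c) < d" for c
  proof (cases "block ?b {1..n} c = {}")
    case True
    then show ?thesis using assms(3,4) by (metis card.empty less_trans)
  next
    case False
    define i where "i = Min (block ?b {1..n} c)"
    have fin: "finite (block ?b {1..n} c)" by simp
    have i: "i \<in> {1..n}" "?b i = c" using Min_in[OF fin False] by (auto simp: i_def)
    have "block ?b {1..n} c \<subseteq> {i..<i + e}"
    proof
      fix j assume j: "j \<in> block ?b {1..n} c"
      have "i \<le> j" unfolding i_def using j by (intro Min_le) auto
      moreover have "j < i + e"
      proof (rule ccontr)
        assume "\<not> j < i + e"
        \<comment> \<open>The largest multiple of \<open>e\<close> below \<open>i + e\<close>. It is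
          at least \<open>i\<close>, so it would be a cut separating \<open>i\<close> from
          \<open>j\<close>.\<close>
        define s where "s = e * ((i + e - 1) div e)"
        have "i + e - 1 = s + (i + e - 1) mod e" by (simp add: s_def)
        moreover have "(i + e - 1) mod e < e" using \<open>0 < e\<close> by simp
        ultimately have s: "i \<le> s" "s < i + e" using \<open>0 < e\<close> by linarith+
        moreover have "e dvd s" by (simp add: s_def)
        ultimately have "s \<in> S"
          using i j \<open>\<not> j < i + e\<close> by (intro mult) auto
        moreover have "s \<notin> S"
          using i j s \<open>\<not> j < i + e\<close> by (intro card_below_eq_imp_notin[OF finS, of i j]) auto
        ultimately show False by simp
      qed
      ultimately show "j \<in> {i..<i + e}" by simp
    qed
    then have "card (block ?b {1..n} c) \<le> e" using card_mono[of "{i..<i+e}"] by fastforce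
    then show ?thesis using assms by simp
  qed
  then have "(\<Sum>xs\<in>block_shuffles ?b {1..n}. q ^ list_maj xs) = 0"
    using assms by (intro maj_block_shuffles_root_of_unity[OF mono_card_below[OF finS]]) auto
  then show ?thesis
    using sum.reindex_bij_betw[OF bij_betw_inverse_descents_block_shuffles[OF S],
        of "\<lambda>xs. q ^ list_maj xs"]
    by (simp only: list_maj_one_line)
qed

section \<open>Vanishing of the bivariate generating function\<close>

text \<open>Writing each factor \<open>y ^ i\<close> with \<open>i\<close> a descent as \<open>y ^ i + 0\<close> and each factor \<open>1\<close> as
  \<open>y ^ i + (1 - y ^ i)\<close> expresses the weight through the indicators of the events that all
  descents lie in a given set.\<close>

lemma power_maj_expand:
  fixes y :: "'b::comm_ring_1"
  shows "y ^ maj n p = (\<Sum>S\<in>Pow {1..<n}. (\<Prod>i\<in>S. y ^ i) * (\<Prod>i\<in>{1..<n} - S. 1 - y ^ i)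
    * (if descents n p \<subseteq> S then 1 else 0))"
proof -
  let ?D = "descents n p"
  let ?f = "\<lambda>i. if i \<in> ?D then 0 else 1 - y ^ i"
  have "y ^ maj n p = (\<Prod>i\<in>?D. y ^ i)"
    unfolding maj_def descents_def by (simp add: power_sum)
  also have "\<dots> = (\<Prod>i\<in>{1..<n}. if i \<in> ?D then y ^ i else 1)"
    by (intro prod.mono_neutral_cong_left) (auto simp: descents_def)
  also have "\<dots> = (\<Prod>i\<in>{1..<n}. y ^ i + ?f i)"
    by (intro prod.cong) auto
  also have "\<dots> = (\<Sum>S\<in>Pow {1..<n}. (\<Prod>i\<in>S. y ^ i) * (\<Prod>i\<in>{1..<n} - S. ?f i))"
    by (rule prod_add) simp
  also have "\<dots> = (\<Sum>S\<in>Pow {1..<n}. (\<Prod>i\<in>S. y ^ i) * (\<Prod>i\<in>{1..<n} - S. 1 - y ^ i)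
    * (if ?D \<subseteq> S then 1 else 0))"
  proof (rule sum.cong[OF refl])
    fix S assume "S \<in> Pow {1..<n}"
    have "(\<Prod>i\<in>{1..<n} - S. ?f i) = (\<Prod>i\<in>{1..<n} - S. 1 - y ^ i) * (if ?D \<subseteq> S then 1 else 0)"
    proof (cases "?D \<subseteq> S")
      case True
      then show ?thesis by (auto intro!: prod.cong)
    next
      case False
      then obtain i where "i \<in> ?D" "i \<notin> S" by auto
      then have "(\<Prod>i\<in>{1..<n} - S. ?f i) = 0"
        by (intro prod_zero) (auto simp: descents_def)
      then show ?thesis using False by simp
    qed
    then show "(\<Prod>i\<in>S. y ^ i) * (\<Prod>i\<in>{1..<n} - S. ?f i) = (\<Prod>i\<in>S. y ^ i) *
      (\<Prod>i\<in>{1..<n} - S. 1 - y ^ i) * (if ?D \<subseteq> S then 1 else 0)" by (simp add: mult.assoc)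
  qed
  finally show ?thesis .
qed

text \<open>After the expansion and an exchange of sums every \<open>S\<close> contributes zero: if
  \<open>S\<close> misses a multiple \<open>s\<close> of \<open>e\<close>, its coefficient has the
  factor \<open>1 - y ^ s = 0\<close>; otherwise the sum of \<open>x ^ maj n p\<close> over the
  selected permutations vanishes.\<close>

lemma maj_bivariate_zero_if_less:
  fixes x y :: "'b::idom"
  assumes "0 < e" "e < d" "d \<le> n" and x: "\<And>m. x ^ m = 1 \<longleftrightarrow> d dvd m" and y: "y ^ e = 1"
  shows "(\<Sum>p | p permutes {1..n}. x ^ maj n p * y ^ maj n (inv p)) = 0"
proof -
  let ?P = "{p. p permutes {1..n}}"
  let ?w = "\<lambda>S. (\<Prod>i\<in>S. y ^ i) * (\<Prod>i\<in>{1..<n} - S. 1 - y ^ i)"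
  have "(\<Sum>p\<in>?P. x ^ maj n p * y ^ maj n (inv p))
    = (\<Sum>S\<in>Pow {1..<n}. \<Sum>p\<in>?P. ?w S * (x ^ maj n p * (if descents n (inv p) \<subseteq> S then 1 else 0)))"
    unfolding power_maj_expand[of y] sum_distrib_left
    by (subst sum.swap) (simp only: mult_ac)
  also have "\<dots> = (\<Sum>S\<in>Pow {1..<n}. 0)"
  proof (rule sum.cong[OF refl])
    fix S assume S: "S \<in> Pow {1..<n}"
    let ?s = "\<Sum>p\<in>?P. x ^ maj n p * (if descents n (inv p) \<subseteq> S then 1 else 0)"
    have "?w S * ?s = 0"
    proof (cases "\<forall>s\<in>{1..<n}. e dvd s \<longrightarrow> s \<in> S")
      case True
      have "?s = (\<Sum>p | p permutes {1..n} \<and> descents n (inv p) \<subseteq> S. x ^ maj n p)"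
        by (intro sum.mono_neutral_cong_right) (auto simp: finite_permutations)
      then show ?thesis
        using maj_inverse_descents_root_of_unity[of S n e d x] S True assms by auto
    next
      case False
      then obtain s where "s \<in> {1..<n} - S" "e dvd s" by auto
      moreover have "y ^ s = 1" using \<open>e dvd s\<close> y by (auto simp: dvd_def power_mult)
      ultimately have "(\<Prod>i\<in>{1..<n} - S. 1 - y ^ i) = 0"
        by (intro prod_zero) auto
      then show ?thesis by simp
    qed
    then show "(\<Sum>p\<in>?P. ?w S * (x ^ maj n p * (if descents n (inv p) \<subseteq> S then 1 else 0))) = 0"
      by (simp only: sum_distrib_left)
  qed
  finally show ?thesis by simp
qed

lemma maj_bivariate_zero:
  fixes x y :: "'b::idom"
  assumes "0 < d" "0 < e" "d \<noteq> e" "d \<le> n" "e \<le> n"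
    and x: "\<And>m. x ^ m = 1 \<longleftrightarrow> d dvd m" and y: "\<And>m. y ^ m = 1 \<longleftrightarrow> e dvd m"
  shows "(\<Sum>p | p permutes {1..n}. x ^ maj n p * y ^ maj n (inv p)) = 0"
proof (cases "e < d")
  case True
  then show ?thesis using assms by (intro maj_bivariate_zero_if_less[of e d]) auto
next
  case False
  \<comment> \<open>Reindexing by inversion exchanges the two exponents and hence the roles of
    \<open>x\<close> and \<open>y\<close>.\<close>
  have "(\<Sum>p | p permutes {1..n}. x ^ maj n p * y ^ maj n (inv p))
    = (\<Sum>p | p permutes {1..n}. y ^ maj n p * x ^ maj n (inv p))"
    by (subst sum_permutations_inverse)
      (auto simp: permutes_inv_inv mult.commute intro!: sum.cong)
  also have "\<dots> = 0"
    using False assms by (intro maj_bivariate_zero_if_less[of d e]) auto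
  finally show ?thesis .
qed

section \<open>Fourier inversion\<close>

definition unity_root :: "nat \<Rightarrow> complex" where
  "unity_root k = cis (2 * pi / real k)"

lemma unity_root_power_eq_1_iff:
  assumes "k > 0"
  shows "unity_root k ^ m = 1 \<longleftrightarrow> k dvd m"
proof -
  have "unity_root k ^ m = cis (2 * pi * real m / real k)"
    by (simp add: unity_root_def Complex.DeMoivre mult_ac)
  also have "\<dots> = 1 \<longleftrightarrow> (\<exists>z::int. 2 * pi * real m / real k = 2 * pi * of_int z)"
  proof -
    have "cis t = 1 \<longleftrightarrow> (\<exists>z::int. t = 2 * pi * of_int z)" for t
    proof
      assume "cis t = 1"
      then have "cos t = 1" by (simp add: complex_eq_iff)
      then show "\<exists>z::int. t = 2 * pi * of_int z"
        unfolding cos_one_2pi_int by (auto simp: mult_ac)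
    qed (auto simp: cis_multiple_2pi)
    then show ?thesis .
  qed
  also have "\<dots> \<longleftrightarrow> (\<exists>z::int. real m = real k * of_int z)"
    using assms by (intro ex_cong1) (simp add: field_simps)
  also have "\<dots> \<longleftrightarrow> (\<exists>z::int. int m = int k * z)"
    by (intro ex_cong1) (metis of_int_eq_iff of_int_mult of_int_of_nat_eq)
  also have "\<dots> \<longleftrightarrow> k dvd m"
    by (metis dvd_def int_dvd_int_iff)
  finally show ?thesis .
qed

text \<open>Orthogonality of characters modulo \<open>k\<close>: a geometric sum whose ratio
  \<open>unity_root k ^ m\<close> is a \<open>k\<close>-th root of unity and equals 1 only if
  \<open>k dvd m\<close>.\<close>

lemma sum_unity_root:
  assumes "k > 0"
  shows "(\<Sum>a<k. (unity_root k ^ a) ^ m) = (if k dvd m then of_nat k else 0)"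
proof -
  have eq: "(unity_root k ^ a) ^ m = (unity_root k ^ m) ^ a" for a
    by (simp add: power_mult[symmetric] mult.commute)
  have "(unity_root k ^ m) ^ k = 1"
    using unity_root_power_eq_1_iff[OF assms, of "m * k"] by (simp add: power_mult)
  then show ?thesis
    unfolding eq using unity_root_power_eq_1_iff[OF assms, of m]
    by (auto simp: sum_gp_strict geometric_sum)
qed

text \<open>The order is \<open>k div gcd a k\<close>. The equivalence is the form in which the
  vanishing lemmas express primitivity.\<close>

lemma unity_root_power_order:
  assumes "k > 0"
  obtains d where "0 < d" "d dvd k" "\<And>m. (unity_root k ^ a) ^ m = 1 \<longleftrightarrow> d dvd m"
proof
  let ?g = "gcd a k"
  obtain d where d: "k = ?g * d" by (meson dvd_def gcd_dvd2)
  have g: "?g > 0" using assms by simp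
  obtain a' where a': "a = ?g * a'" by (meson dvd_def gcd_dvd1)
  have cop: "coprime a' d"
  proof -
    have "?g * gcd a' d = ?g" using a' d by (metis gcd_mult_distrib_nat)
    then have "gcd a' d = 1" using g by (metis mult_cancel1 mult.right_neutral not_less0)
    then show ?thesis by (simp only: coprime_iff_gcd_eq_1)
  qed
  have kd: "k div ?g = d" using d g by (metis nonzero_mult_div_cancel_left not_less0)
  show "0 < k div ?g" using kd d assms by (cases d) auto
  show "k div ?g dvd k" using kd d by (metis dvd_triv_right)
  show "(unity_root k ^ a) ^ m = 1 \<longleftrightarrow> k div ?g dvd m" for m
  proof -
    have "(unity_root k ^ a) ^ m = 1 \<longleftrightarrow> k dvd a * m"
      using unity_root_power_eq_1_iff[OF assms, of "a * m"] by (simp add: power_mult)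
    also have "\<dots> \<longleftrightarrow> ?g * d dvd ?g * (a' * m)"
      using a' d by (metis mult.assoc)
    also have "\<dots> \<longleftrightarrow> d dvd a' * m"
      using g by (rule nat_mult_dvd_cancel1)
    also have "\<dots> \<longleftrightarrow> d dvd m"
      using cop by (simp add: coprime_dvd_mult_right_iff coprime_commute)
    finally show ?thesis using kd by simp
  qed
qed

text \<open>\<open>(k - 1) * i\<close> represents minus \<open>i\<close> modulo \<open>k\<close>
  within the natural numbers.\<close>

lemma cong_iff_dvd_add:
  fixes k m i :: nat
  assumes "k > 0"
  shows "[m = i] (mod k) \<longleftrightarrow> k dvd m + (k - 1) * i"
proof -
  have "k dvd m + (k - 1) * i \<longleftrightarrow> [m + (k - 1) * i = i + (k - 1) * i] (mod k)"
  proof -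
    have "i + (k - 1) * i = k * i" using assms by (cases k) auto
    then show ?thesis by (simp add: cong_def dvd_eq_mod_eq_0)
  qed
  then show ?thesis by (simp add: cong_add_rcancel_nat)
qed

theorem theorem1p1:
  fixes n k l i j :: nat
  assumes "n > 0" and "k > 0" and "l > 0"
    and "coprime k l" and "k \<le> n" and "l \<le> n"
  shows "real (maj_count n k l i j) = fact n / (real k * real l)"
proof -
  let ?P = "{p. p permutes {1..n}}"
  let ?z = "unity_root k" and ?w = "unity_root l"
  let ?I = "(k - 1) * i" and ?J = "(l - 1) * j"
  let ?A = "\<lambda>a b. \<Sum>p\<in>?P. (?z ^ a) ^ maj n p * (?w ^ b) ^ maj n (inv p)"
  have fin: "finite ?P" by (simp add: finite_permutations)
  have zero: "?A a b = 0" if ab: "a < k" "b < l" "(a, b) \<noteq> (0, 0)" for a b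
  proof -
    obtain d where d: "0 < d" "d dvd k" "\<And>m. (?z ^ a) ^ m = 1 \<longleftrightarrow> d dvd m"
      using unity_root_power_order[OF assms(2)] by metis
    obtain e where e: "0 < e" "e dvd l" "\<And>m. (?w ^ b) ^ m = 1 \<longleftrightarrow> e dvd m"
      using unity_root_power_order[OF assms(3)] by metis
    \<comment> \<open>A common order divides both \<open>k\<close> and \<open>l\<close>, so it is 1
      by coprimality, which forces \<open>a = b = 0\<close>.\<close>
    have "d \<noteq> e"
    proof
      assume "d = e"
      then have "d = 1" "e = 1" using d(2) e(2) assms(4)
        by (metis coprime_common_divisor_nat)+
      then have "?z ^ a = 1" "?w ^ b = 1" using d(3)[of 1] e(3)[of 1] by auto
      then have "k dvd a" "l dvd b"
        using unity_root_power_eq_1_iff assms(2,3) by auto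
      then show False using ab by (auto dest: dvd_imp_le)
    qed
    \<comment> \<open>The orders divide \<open>k\<close> and \<open>l\<close>, so the bounds
      \<open>k \<le> n\<close> and \<open>l \<le> n\<close> pass to them.\<close>
    moreover have "d \<le> n" "e \<le> n"
      using dvd_imp_le[OF d(2)] dvd_imp_le[OF e(2)] assms by auto
    ultimately show ?thesis using d e by (intro maj_bivariate_zero[of d e]) auto
  qed
  have A0: "?A 0 0 = fact n"
    using card_permutations[of "{1..n}" n] by simp
  have "of_nat (maj_count n k l i j) * (of_nat k * of_nat l)
    = (\<Sum>p | p \<in> ?P \<and> [maj n p = i] (mod k) \<and> [maj n (inv p) = j] (mod l). of_nat k * of_nat l :: complex)"
    by (simp add: maj_count_def)
  \<comment> \<open>The weight \<open>k * l\<close> on the counted permutations becomes a product of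
    two divisibility indicators, each of which is then a sum over powers of a root of unity.\<close>
  also have "\<dots> = (\<Sum>p\<in>?P. (if k dvd maj n p + ?I then of_nat k else 0)
      * (if l dvd maj n (inv p) + ?J then of_nat l else 0))"
    using fin cong_iff_dvd_add[OF assms(2)] cong_iff_dvd_add[OF assms(3)]
    by (intro sum.mono_neutral_cong_left) auto
  also have "\<dots> = (\<Sum>p\<in>?P. (\<Sum>a<k. (?z ^ a) ^ (maj n p + ?I)) * (\<Sum>b<l. (?w ^ b) ^ (maj n (inv p) + ?J)))"
    by (simp only: sum_unity_root[OF assms(2)] sum_unity_root[OF assms(3)])
  also have "\<dots> = (\<Sum>p\<in>?P. \<Sum>a<k. \<Sum>b<l. (?z ^ a) ^ ?I * (?w ^ b) ^ ?J
      * ((?z ^ a) ^ maj n p * (?w ^ b) ^ maj n (inv p)))"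
    by (simp only: sum_product power_add mult_ac)
  also have "\<dots> = (\<Sum>a<k. \<Sum>p\<in>?P. \<Sum>b<l. (?z ^ a) ^ ?I * (?w ^ b) ^ ?J
      * ((?z ^ a) ^ maj n p * (?w ^ b) ^ maj n (inv p)))"
    by (rule sum.swap)
  also have "\<dots> = (\<Sum>a<k. \<Sum>b<l. (?z ^ a) ^ ?I * (?w ^ b) ^ ?J * ?A a b)"
    unfolding sum_distrib_left by (intro sum.cong[OF refl] sum.swap)
  \<comment> \<open>Only the pair of trivial characters survives. Its phase factors are 1 and its
    sum counts all permutations.\<close>
  also have "\<dots> = (\<Sum>a<k. if a = 0 then fact n else 0)"
  proof (rule sum.cong[OF refl])
    fix a assume a: "a \<in> {..<k}"
    have "(\<Sum>b<l. (?z ^ a) ^ ?I * (?w ^ b) ^ ?J * ?A a b)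
       = (\<Sum>b<l. if b = 0 then (if a = 0 then fact n else 0) else 0)"
    proof (rule sum.cong[OF refl])
      fix b assume b: "b \<in> {..<l}"
      show "(?z ^ a) ^ ?I * (?w ^ b) ^ ?J * ?A a b
          = (if b = 0 then (if a = 0 then fact n else 0) else 0)"
      proof (cases "(a, b) = (0, 0)")
        case True
        then show ?thesis using A0 by simp
      next
        case False
        then show ?thesis using zero[of a b] a b by auto
      qed
    qed
    then show "(\<Sum>b<l. (?z ^ a) ^ ?I * (?w ^ b) ^ ?J * ?A a b) = (if a = 0 then fact n else 0)"
      using assms(3) by simp
  qed
  also have "\<dots> = fact n" using assms(2) by simp
  finally have "of_nat (maj_count n k l i j * (k * l)) = (of_nat (fact n) :: complex)"
    by simp
  then have "maj_count n k l i j * (k * l) = fact n"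
    by (simp only: of_nat_eq_iff)
  then have "real (maj_count n k l i j) * (real k * real l) = fact n"
    by (metis of_nat_fact of_nat_mult)
  then show ?thesis using assms(2,3) by (simp add: field_simps)
qed

end
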